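(* Let $\Omega$ and $\hat\Omega$ be finite sets and let $L$ be the generator of a Markov process with state space $\Omega$. Let $\mathfrak{g}$ be a (finite-dimensional, complex) Lie algebra with basis $\mathbf{x}_1,\ldots,\mathbf{x}_n$, and let $X_1,\ldots,X_n$ be linear operators on $\mathbb{C}^\Omega$ that form a representation of $\mathfrak{g}$ (with $X_i$ representing $\mathbf{x}_i$). Assume that $L$ can be written as a linear combination of products of the operators $X_1,\ldots,X_n$, $$L=\sum_{(i_1,\ldots,i_k)\in\mathcal{I}}r_{i_1,\ldots,i_k}X_{i_1}\cdots X_{i_k},$$ where $\mathcal{I}$ is some finite set whose elements are sequences $(i_1,\ldots,i_k)$ with $k\geq 0$ and $1\leq i_m\leq n$ for each $m$. Assume that $Y_1,\ldots,Y_n$ are linear operators on $\mathbb{C}^{\hat\Omega}$ that define a representation of the conjugate Lie algebra $\overline{\mathfrak{g}}$ (with $Y_i$ representing $\overline{\mathbf{x}_i}$). Assume that the representations of $\mathfrak{g}$ defined by $Y_1^\dagger,\ldots,Y_n^\dagger$ and by $X_1,\ldots,X_n$ are equivalent. Then there is a bijective intertwiner $D:\mathbb{C}^{\hat\Omega}\to\mathbb{C}^\Omega$, i.e., $X_iD=DY_i^\dagger$ for each $i=1,\ldots,n$, and $L$ is dual with respect to the duality function $D$ to the operator $$\hat L:=\sum_{(i_1,\ldots,i_k)\in\mathcal{I}}r_{i_1,\ldots,i_k}Y_{i_k}\cdots Y_{i_1},$$ i.e., $LD=D\hat L^\dagger$.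
   Context: A generator of a (continuous-time) Markov process with finite state space $\Omega$ is a real matrix $L$ with $L(x,y)\geq 0$ for $x\neq y$ and $\sum_y L(x,y)=0$; it is identified with the linear operator $Lf(x)=\sum_{y}L(x,y)f(y)$. Functions $D:\Omega\times\hat\Omega\to\mathbb{C}$ are identified with matrices and hence with linear operators $D:\mathbb{C}^{\hat\Omega}\to\mathbb{C}^\Omega$, $Df(x)=\sum_{y\in\hat\Omega}D(x,y)f(y)$. The adjoint of a matrix $A$ is $A^\dagger(x,y):=A(y,x)$ for real matrices, and $A^\dagger(x,y):=\overline{A(y,x)}$ for matrices over the complex numbers. An operator $L$ on functions on $\Omega$ is dual to an operator $\hat L$ on functions on $\hat\Omega$ with duality function $D$ if $LD=D\hat L^\dagger$ ($\hat L$ is not required to be a Markov generator). If $\mathfrak{g}$ has basis $\mathbf{x}_1,\ldots,\mathbf{x}_n$ with $[\mathbf{x}_i,\mathbf{x}_j]=\sum_k c_{ijk}\mathbf{x}_k$, then operators $X_1,\ldots,X_n$ on a complex linear space form a representation of $\mathfrak{g}$ if $[X_i,X_j]:=X_iX_j-X_jX_i=\sum_k c_{ijk}X_k$ for all $i,j$. The conjugate Lie algebra $\overline{\mathfrak{g}}$ of $\mathfrak{g}$ is a complex Lie algebra together with a conjugate-linear bijection $\mathfrak{g}\ni\mathbf{x}\mapsto\overline{\mathbf{x}}\in\overline{\mathfrak{g}}$ such that $[\overline{\mathbf{x}},\overline{\mathbf{y}}]=\overline{[\mathbf{y},\mathbf{x}]}$; thus $Y_1,\ldots,Y_n$ form a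 representation of $\overline{\mathfrak{g}}$ if $[Y_i,Y_j]=\sum_k\overline{c_{jik}}\,Y_k$ for all $i,j$. In that case $Y_1^\dagger,\ldots,Y_n^\dagger$ define a representation of $\mathfrak{g}$. Two representations of $\mathfrak{g}$, on $V$ and $W$, are equivalent if there is a bijective linear map (intertwiner) $\phi:V\to W$ commuting with the action of $\mathfrak{g}$. The product over an empty sequence ($k=0$) is the identity operator.
   Formalization: The coefficients r are taken to be real; with complex r the stated formula for the dual operator fails (e.g. X_1 = -iL, r = i, Y_1 the adjoint of X_1, L nonzero), since the adjoint conjugates the coefficients. *)

theory Defs
  imports "HOL-Analysis.Analysis"
begin

text \<open>Functions on a finite set are vectors indexed by a finite type, and operators between
  function spaces are matrices: \<open>complex^'b^'a\<close> maps functions on \<open>'b\<close> to functions on \<open>'a\<close>.\<close>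

definition markov_generator :: "real^'a^'a \<Rightarrow> bool" where
  "markov_generator L \<longleftrightarrow>
     (\<forall>x y. x \<noteq> y \<longrightarrow> L $ x $ y \<ge> 0) \<and> (\<forall>x. (\<Sum>y\<in>UNIV. L $ x $ y) = 0)"

definition complexify :: "real^'b^'a \<Rightarrow> complex^'b^'a" where
  "complexify A = (\<chi> x y. complex_of_real (A $ x $ y))"

definition mat_adjoint :: "complex^'b^'a \<Rightarrow> complex^'a^'b"  ("_\<^sup>\<dagger>" [1000] 999) where
  "A\<^sup>\<dagger> = (\<chi> x y. cnj (A $ y $ x))"

definition dual_wrt :: "complex^'a^'a \<Rightarrow> complex^'b^'b \<Rightarrow> complex^'b^'a \<Rightarrow> bool" where
  "dual_wrt L L' D \<longleftrightarrow> L ** D = D ** L'\<^sup>\<dagger>"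

text \<open>\<open>*s\<close> scales a vector by an element of the entries' type, so it scales a matrix only row by
  row; \<open>*\<^sub>R\<close> is restricted to real scalars.\<close>

definition mat_scale :: "complex \<Rightarrow> complex^'b^'a \<Rightarrow> complex^'b^'a" where
  "mat_scale c A = (\<chi> x. c *s (A $ x))"

definition word_prod :: "(nat \<Rightarrow> complex^'a^'a) \<Rightarrow> nat list \<Rightarrow> complex^'a^'a" where
  "word_prod X is = foldr (\<lambda>i A. X i ** A) is (mat 1)"

locale complex_lie_algebra = vector_space scale
  for scale :: "complex \<Rightarrow> 'g::ab_group_add \<Rightarrow> 'g" +
  fixes bracket :: "'g \<Rightarrow> 'g \<Rightarrow> 'g"
  assumes bracket_add_left: "bracket (u + v) w = bracket u w + bracket v w"
    and bracket_add_right: "bracket u (v + w) = bracket u v + bracket u w"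
    and bracket_scale_left: "bracket (scale c u) v = scale c (bracket u v)"
    and bracket_scale_right: "bracket u (scale c v) = scale c (bracket u v)"
    and bracket_self: "bracket u u = 0"
    and jacobi: "bracket u (bracket v w) + bracket v (bracket w u) + bracket w (bracket u v) = 0"
begin

definition indexed_basis :: "nat \<Rightarrow> (nat \<Rightarrow> 'g) \<Rightarrow> bool" where
  "indexed_basis n x \<longleftrightarrow>
     inj_on x {1..n} \<and> independent (x ` {1..n}) \<and> span (x ` {1..n}) = UNIV"

text \<open>Coefficient of \<open>x k\<close> in the expansion of \<open>v\<close> in the basis \<open>x 1, \<dots>, x n\<close>.\<close>

definition coord :: "nat \<Rightarrow> (nat \<Rightarrow> 'g) \<Rightarrow> 'g \<Rightarrow> nat \<Rightarrow> complex" where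
  "coord n x v k = representation (x ` {1..n}) v (x k)"

definition structure_const :: "nat \<Rightarrow> (nat \<Rightarrow> 'g) \<Rightarrow> nat \<Rightarrow> nat \<Rightarrow> nat \<Rightarrow> complex" where
  "structure_const n x i j k = coord n x (bracket (x i) (x j)) k"

definition forms_representation ::
    "nat \<Rightarrow> (nat \<Rightarrow> 'g) \<Rightarrow> (nat \<Rightarrow> complex^'a^'a) \<Rightarrow> bool" where
  "forms_representation n x X \<longleftrightarrow>
     (\<forall>i\<in>{1..n}. \<forall>j\<in>{1..n}.
        X i ** X j - X j ** X i = (\<Sum>k=1..n. mat_scale (structure_const n x i j k) (X k)))"

text \<open>The operator by which \<open>v\<close> acts when each basis element \<open>x k\<close> acts by \<open>X k\<close>.\<close>

definition action ::
    "nat \<Rightarrow> (nat \<Rightarrow> 'g) \<Rightarrow> (nat \<Rightarrow> complex^'a^'a) \<Rightarrow> 'g \<Rightarrow> complex^'a^'a" where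
  "action n x X v = (\<Sum>k=1..n. mat_scale (coord n x v k) (X k))"

definition equivalent_representations ::
    "nat \<Rightarrow> (nat \<Rightarrow> 'g) \<Rightarrow> (nat \<Rightarrow> complex^'a^'a) \<Rightarrow> (nat \<Rightarrow> complex^'b^'b) \<Rightarrow> bool" where
  "equivalent_representations n x V W \<longleftrightarrow>
     (\<exists>\<phi> :: complex^'a \<Rightarrow> complex^'b. Vector_Spaces.linear (*s) (*s) \<phi> \<and> bij \<phi> \<and>
        (\<forall>v f. \<phi> (action n x V v *v f) = action n x W v *v \<phi> f))"

end

locale conjugate_lie_algebra =
  g: complex_lie_algebra scale bracket + conj: complex_lie_algebra scale' bracket'
  for scale :: "complex \<Rightarrow> 'g::ab_group_add \<Rightarrow> 'g" and bracket
    and scale' :: "complex \<Rightarrow> 'h::ab_group_add \<Rightarrow> 'h" and bracket' +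
  fixes cj :: "'g \<Rightarrow> 'h"
  assumes cj_bij: "bij cj"
    and cj_add: "cj (u + v) = cj u + cj v"
    and cj_scale: "cj (scale c u) = scale' (cnj c) (cj u)"
    and cj_bracket: "bracket' (cj u) (cj v) = cj (bracket v u)"

end

theory Submission
  imports Defs
begin

text \<open>
  The idea is that one identity for the generators of the Lie algebra spreads to all words in them.
  An intertwiner is a linear map, hence multiplication by a matrix \<open>D\<close>. It commutes
  with the action of every Lie algebra element; since a basis element acts by its own operator
  (\<open>action_basis\<close>), this means \<open>X i ** D = D ** (Y i)\<^sup>\<dagger>\<close>. Moving \<open>D\<close> to the left through the
  letters of a word one at a time gives the same relation for products
  (\<open>word_prod_intertwine\<close>), with the letters \<open>(Y i)\<^sup>\<dagger>\<close> in the original order. Because the adjoint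
  reverses products, this product of adjoints is the adjoint of the reversed word in \<open>Y\<close>
  (\<open>word_prod_rev_adjoint\<close>), which is why \<open>rev\<close> appears in the dual operator. The adjoint is only
  conjugate-linear, but the coefficients \<open>r\<close> are real, so a linear combination of words keeps its
  coefficients and the word identities add up to the duality relation.
\<close>

lemma mat_adjoint_mult: "(A ** B)\<^sup>\<dagger> = B\<^sup>\<dagger> ** A\<^sup>\<dagger>"
  by (simp add: mat_adjoint_def matrix_matrix_mult_def vec_eq_iff mult.commute)

lemma mat_adjoint_one: "(mat 1)\<^sup>\<dagger> = mat 1"
  by (auto simp: mat_adjoint_def mat_def vec_eq_iff)

lemma mat_adjoint_real_combination:
  "(\<Sum>i\<in>I. (r i :: real) *\<^sub>R A i)\<^sup>\<dagger> = (\<Sum>i\<in>I. r i *\<^sub>R (A i)\<^sup>\<dagger>)"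
  by (simp add: mat_adjoint_def vec_eq_iff)

lemma word_prod_Nil: "word_prod X [] = mat 1"
  by (simp add: word_prod_def)

lemma word_prod_Cons: "word_prod X (i # is) = X i ** word_prod X is"
  by (simp add: word_prod_def)

lemma word_prod_snoc: "word_prod X (is @ [i]) = word_prod X is ** X i"
  by (induction "is") (simp_all add: word_prod_Nil word_prod_Cons matrix_mul_assoc)

text \<open>Reversing the word and taking the adjoint each turn the order of the factors around, so
  together they leave it unchanged and only the letters become adjoints.\<close>

lemma word_prod_rev_adjoint: "(word_prod Y (rev is))\<^sup>\<dagger> = word_prod (\<lambda>i. (Y i)\<^sup>\<dagger>) is"
  by (induction "is")
    (simp_all add: word_prod_Nil word_prod_Cons word_prod_snoc mat_adjoint_mult mat_adjoint_one)

text \<open>Each letter lets \<open>D\<close> pass, so \<open>D\<close> can travel from the right end of the word to the left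
  end. The relation is required for the letters of this word only, because \<open>X\<close> is indexed by all
  natural numbers but intertwined only on the indices of the basis.\<close>

lemma word_prod_intertwine:
  assumes "\<And>i. i \<in> set is \<Longrightarrow> X i ** D = D ** Z i"
  shows "word_prod X is ** D = D ** word_prod Z is"
  using assms
proof (induction "is")
  case Nil
  show ?case by (simp add: word_prod_Nil)
next
  case (Cons i "is")
  have "word_prod X (i # is) ** D = X i ** (word_prod X is ** D)"
    by (simp add: word_prod_Cons matrix_mul_assoc)
  also have "word_prod X is ** D = D ** word_prod Z is"
    using Cons by simp
  also have "X i ** (D ** word_prod Z is) = (X i ** D) ** word_prod Z is"
    by (rule matrix_mul_assoc)
  also have "X i ** D = D ** Z i"
    using Cons.prems by simp
  also have "D ** Z i ** word_prod Z is = D ** word_prod Z (i # is)"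
    by (simp add: word_prod_Cons matrix_mul_assoc)
  finally show ?case .
qed

lemma matrix_add_rdistrib: "(A + B) ** C = A ** C + B ** C"
  by (simp add: matrix_matrix_mult_def vec_eq_iff distrib_right sum.distrib)

lemma real_combination_intertwine:
  fixes D :: "complex^'b^'a" and A :: "'i \<Rightarrow> complex^'a^'a" and B :: "'i \<Rightarrow> complex^'b^'b"
  assumes "\<And>i. i \<in> I \<Longrightarrow> A i ** D = D ** B i"
  shows "(\<Sum>i\<in>I. (r i :: real) *\<^sub>R A i) ** D = D ** (\<Sum>i\<in>I. r i *\<^sub>R B i)"
proof -
  have "(\<Sum>i\<in>I. r i *\<^sub>R A i) ** D = (\<Sum>i\<in>I. r i *\<^sub>R (A i ** D))"
    by (induction I rule: infinite_finite_induct)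
      (simp_all add: matrix_add_rdistrib flip: scalar_matrix_assoc)
  also have "\<dots> = (\<Sum>i\<in>I. r i *\<^sub>R (D ** B i))"
    using assms by simp
  also have "\<dots> = D ** (\<Sum>i\<in>I. r i *\<^sub>R B i)"
    by (induction I rule: infinite_finite_induct)
      (simp_all add: matrix_add_ldistrib matrix_scalar_ac scalar_matrix_assoc)
  finally show ?thesis .
qed

context complex_lie_algebra
begin

lemma coord_basis:
  assumes "indexed_basis n x" "i \<in> {1..n}" "k \<in> {1..n}"
  shows "coord n x (x i) k = (if k = i then 1 else 0)"
proof -
  have "independent (x ` {1..n})" and inj: "inj_on x {1..n}"
    using assms(1) by (simp_all add: indexed_basis_def)
  then have "coord n x (x i) k = (if x k = x i then 1 else 0)"
    unfolding coord_def using assms(2) by (subst representation_basis) auto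
  then show ?thesis
    using inj_on_eq_iff[OF inj assms(3,2)] by simp
qed

text \<open>Links an intertwiner, which respects the action of every element of the Lie algebra, to the
  relations between the given operators.\<close>

lemma action_basis:
  assumes "indexed_basis n x" and i: "i \<in> {1..n}"
  shows "action n x X (x i) = X i"
proof -
  have "action n x X (x i) = (\<Sum>k=1..n. if k = i then X k else 0)"
    unfolding action_def
  proof (rule sum.cong[OF refl])
    fix k assume "k \<in> {1..n}"
    with assms have "coord n x (x i) k = (if k = i then 1 else 0)"
      by (rule coord_basis)
    then show "mat_scale (coord n x (x i) k) (X k) = (if k = i then X k else 0)"
      by (simp add: mat_scale_def vec_eq_iff)
  qed
  then show ?thesis using i by simp
qed

end

theorem proposition9:
  fixes L :: "real^'a^'a"
    and scale :: "complex \<Rightarrow> 'g::ab_group_add \<Rightarrow> 'g" and bracket :: "'g \<Rightarrow> 'g \<Rightarrow> 'g"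
    and scale' :: "complex \<Rightarrow> 'h::ab_group_add \<Rightarrow> 'h" and bracket' :: "'h \<Rightarrow> 'h \<Rightarrow> 'h"
    and cj :: "'g \<Rightarrow> 'h"
    and n :: nat and x :: "nat \<Rightarrow> 'g"
    and X :: "nat \<Rightarrow> complex^'a^'a" and Y :: "nat \<Rightarrow> complex^'b^'b"
    and \<I> :: "nat list set" and r :: "nat list \<Rightarrow> real"
  assumes "markov_generator L"
    and "complex_lie_algebra scale bracket"
    and "complex_lie_algebra.indexed_basis scale n x"
    and "complex_lie_algebra.forms_representation scale bracket n x X"
    and "finite \<I>" and "\<I> \<subseteq> lists {1..n}"
    and "complexify L = (\<Sum>is\<in>\<I>. r is *\<^sub>R word_prod X is)"
    and "conjugate_lie_algebra scale bracket scale' bracket' cj"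
    and "complex_lie_algebra.forms_representation scale' bracket' n (\<lambda>i. cj (x i)) Y"
    and "complex_lie_algebra.equivalent_representations scale n x (\<lambda>i. (Y i)\<^sup>\<dagger>) X"
  shows "\<exists>D :: complex^'b^'a.
           bij (\<lambda>f. D *v f) \<and>
           (\<forall>i\<in>{1..n}. X i ** D = D ** (Y i)\<^sup>\<dagger>) \<and>
           dual_wrt (complexify L) (\<Sum>is\<in>\<I>. r is *\<^sub>R word_prod Y (rev is)) D"
proof -
  interpret complex_lie_algebra scale bracket by fact
  obtain \<phi> :: "complex^'b \<Rightarrow> complex^'a"
    where lin: "Vector_Spaces.linear (*s) (*s) \<phi>" and "bij \<phi>"
      and equiv: "\<And>v f. \<phi> (action n x (\<lambda>i. (Y i)\<^sup>\<dagger>) v *v f) = action n x X v *v \<phi> f"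
    using assms(10) unfolding equivalent_representations_def by blast
  define D where "D = matrix \<phi>"
  have D: "D *v f = \<phi> f" for f
    unfolding D_def by (rule matrix_works[OF lin])
  have inter: "X i ** D = D ** (Y i)\<^sup>\<dagger>" if "i \<in> {1..n}" for i
  proof -
    have "\<phi> ((Y i)\<^sup>\<dagger> *v f) = X i *v \<phi> f" for f
      using equiv[of "x i"] by (simp only: action_basis[OF assms(3) that])
    then show ?thesis
      by (simp add: matrix_eq D flip: matrix_vector_mul_assoc)
  qed
  \<comment> \<open>The words in \<open>\<I>\<close> use only letters from \<open>{1..n}\<close>, where the intertwining relation holds.\<close>
  have "word_prod X is ** D = D ** (word_prod Y (rev is))\<^sup>\<dagger>" if "is \<in> \<I>" for "is"
    unfolding word_prod_rev_adjoint
    using that assms(6) by (intro word_prod_intertwine inter) auto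
  then have "dual_wrt (complexify L) (\<Sum>is\<in>\<I>. r is *\<^sub>R word_prod Y (rev is)) D"
    unfolding dual_wrt_def assms(7) mat_adjoint_real_combination
    by (rule real_combination_intertwine)
  then show ?thesis
    using inter \<open>bij \<phi>\<close> by (auto simp: D intro!: exI[of _ D])
qed

end
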